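(* Let $S$ be a partially ordered countable set, $0\notin S$, and let $Q$ be the transition matrix of a Markov chain on $S\cup\{0\}$ absorbed at $0$ ($Q(0,0)=1$), with $Q(x,0)<1$ for all $x\in S$. If $$Q(x,0)\ge Q(x',0)\quad\text{for all }x\le x'\text{ in }S,$$ and $\underline\nu$ is a quasi-stationary distribution such that $\underline\nu\preccurlyeq\nu$ for any other quasi-stationary distribution $\nu$, then $\underline\nu=\nu_{\min}$, i.e. $\underline\nu$ is a minimal quasi-stationary distribution: $a(\underline\nu)=a_*$.
   Context: $\preccurlyeq$ denotes the stochastic order of probability measures on $S$ induced by the partial order on $S$. For a probability measure $\nu$ on $S$, $\nu T_1(y):=\frac{\nu Q(y)}{1-\nu Q(0)}$ for $y\in S$; a probability measure $\nu$ on $S$ is a quasi-stationary distribution if $\nu=\nu T_1$. Put $a(\nu):=1-\nu Q(0)$, where $\nu Q(0)=\sum_{x\in S}\nu(x)Q(x,0)$, and $a_*:=\inf\{a(\nu):\nu\text{ is a quasi-stationary distribution}\}$. A quasi-stationary distribution $\nu$ with $a(\nu)=a_*$ is called minimal and denoted $\nu_{\min}$. *)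

theory Defs
  imports "HOL-Probability.Probability"
begin

text \<open>
  The countable poset \<open>S\<close> is a type \<open>'s\<close> of class \<open>{countable, order}\<close>. The state space
  \<open>S \<union> {0}\<close> is \<open>'s option\<close>, with \<open>None\<close> as the absorbing state \<open>0\<close>; thus the transition matrix
  entry \<open>Q(x, y)\<close> for \<open>x, y \<in> S\<close> is \<open>pmf (Q (Some x)) (Some y)\<close>, and \<open>Q(x, 0)\<close> is
  \<open>pmf (Q (Some x)) None\<close>.
\<close>

definition stoch_le :: "'s::order pmf \<Rightarrow> 's pmf \<Rightarrow> bool"  (infix \<open>\<preceq>\<^sub>s\<^sub>t\<close> 50) where
  "\<mu> \<preceq>\<^sub>s\<^sub>t \<nu> \<longleftrightarrow>
     (\<forall>f :: 's \<Rightarrow> real. mono f \<longrightarrow> bounded (range f) \<longrightarrow>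
        measure_pmf.expectation \<mu> f \<le> measure_pmf.expectation \<nu> f)"

definition push :: "('s option \<Rightarrow> 's option pmf) \<Rightarrow> 's pmf \<Rightarrow> 's option \<Rightarrow> real" where
  "push Q \<nu> y = (\<Sum>\<^sub>\<infinity>x. pmf \<nu> x * pmf (Q (Some x)) y)"

definition T1 :: "('s option \<Rightarrow> 's option pmf) \<Rightarrow> 's pmf \<Rightarrow> 's \<Rightarrow> real" where
  "T1 Q \<nu> y = push Q \<nu> (Some y) / (1 - push Q \<nu> None)"

definition qsd :: "('s option \<Rightarrow> 's option pmf) \<Rightarrow> 's pmf \<Rightarrow> bool" where
  "qsd Q \<nu> \<longleftrightarrow> pmf \<nu> = T1 Q \<nu>"

definition survival :: "('s option \<Rightarrow> 's option pmf) \<Rightarrow> 's pmf \<Rightarrow> real" where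
  "survival Q \<nu> = 1 - push Q \<nu> None"

definition survival_inf :: "('s option \<Rightarrow> 's option pmf) \<Rightarrow> real" where
  "survival_inf Q = Inf {survival Q \<nu> | \<nu>. qsd Q \<nu>}"

definition minimal_qsd :: "('s option \<Rightarrow> 's option pmf) \<Rightarrow> 's pmf \<Rightarrow> bool" where
  "minimal_qsd Q \<nu> \<longleftrightarrow> qsd Q \<nu> \<and> survival Q \<nu> = survival_inf Q"

end

theory Submission
  imports Defs
begin

text \<open>The survival probability a(\<nu>) is the \<nu>-mean of 1 - Q(x,0), a bounded function of
  x that is nondecreasing by the hypothesis on Q. So a is monotone for the stochastic order
  (\<open>survival_mono\<close>), and a quasi-stationary distribution below all others attains the
  infimum of a.\<close>

lemma push_eq_expectation:
  fixes Q :: "'s option \<Rightarrow> 's option pmf"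
  shows "push Q \<nu> y = measure_pmf.expectation \<nu> (\<lambda>x. pmf (Q (Some x)) y)"
proof -
  let ?g = "\<lambda>x. pmf \<nu> x * pmf (Q (Some x)) y"
  \<comment> \<open>Absolute summability, by domination with \<open>pmf \<nu>\<close>, makes the
    unordered sum in \<open>push\<close> agree with the integral.\<close>
  have "Infinite_Set_Sum.abs_summable_on ?g UNIV"
  proof (rule Infinite_Set_Sum.abs_summable_on_comparison_test)
    show "Infinite_Set_Sum.abs_summable_on (pmf \<nu>) UNIV"
      by (rule pmf_abs_summable)
    show "norm (?g x) \<le> norm (pmf \<nu> x)" for x
      by (simp add: mult_left_le pmf_le_1)
  qed
  then show ?thesis
    unfolding push_def pmf_expectation_eq_infsetsum by (simp add: infsetsum_infsum)
qed

lemma survival_mono: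
  fixes Q :: "'s::order option \<Rightarrow> 's option pmf"
  assumes "\<And>x x'. x \<le> x' \<Longrightarrow> pmf (Q (Some x')) None \<le> pmf (Q (Some x)) None"
    and "\<mu> \<preceq>\<^sub>s\<^sub>t \<nu>"
  shows "survival Q \<mu> \<le> survival Q \<nu>"
proof -
  \<comment> \<open>The sign turns the decreasing absorption probability into an increasing test
    function; the constant 1 in \<open>survival\<close> cancels.\<close>
  let ?f = "\<lambda>x. - pmf (Q (Some x)) None"
  have "mono ?f"
    using assms(1) by (auto intro: monoI)
  moreover have "bounded (range ?f)"
    by (auto simp: bounded_iff intro!: exI[of _ 1] pmf_le_1)
  ultimately have "measure_pmf.expectation \<mu> ?f \<le> measure_pmf.expectation \<nu> ?f"
    using assms(2) unfolding stoch_le_def by blast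
  then show ?thesis
    by (simp add: survival_def push_eq_expectation)
qed

theorem lemma4:
  fixes Q :: "'s::{countable, order} option \<Rightarrow> 's option pmf"
    and \<nu>\<^sub>0 :: "'s pmf"
  assumes "pmf (Q None) None = 1"
    and "\<And>x. pmf (Q (Some x)) None < 1"
    and "\<And>x x'. x \<le> x' \<Longrightarrow> pmf (Q (Some x)) None \<ge> pmf (Q (Some x')) None"
    and "qsd Q \<nu>\<^sub>0"
    and "\<And>\<nu>. qsd Q \<nu> \<Longrightarrow> \<nu> \<noteq> \<nu>\<^sub>0 \<Longrightarrow> \<nu>\<^sub>0 \<preceq>\<^sub>s\<^sub>t \<nu>"
  shows "minimal_qsd Q \<nu>\<^sub>0"
proof -
  have "survival Q \<nu>\<^sub>0 \<le> survival Q \<nu>" if "qsd Q \<nu>" for \<nu>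
  \<comment> \<open>The order hypothesis covers only the other quasi-stationary
    distributions.\<close>
  proof (cases "\<nu> = \<nu>\<^sub>0")
    case False
    then show ?thesis
      using survival_mono[of Q] assms(3) assms(5)[OF that] by blast
  qed simp
  then have "survival_inf Q = survival Q \<nu>\<^sub>0"
    \<comment> \<open>The lower bound belongs to the set, so \<open>Inf\<close> is a true
      minimum.\<close>
    unfolding survival_inf_def using assms(4) by (intro cInf_eq_minimum) auto
  then show ?thesis
    using assms(4) by (simp add: minimal_qsd_def)
qed

end
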